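(* Let $n$ be a positive integer. The largest value of $\varepsilon>0$ such that an equilateral $H$-triangle of side $n+\varepsilon$ can be covered by $n^2+3$ equilateral $H$-triangles of side $1$ is $\varepsilon=1/n$ (i.e., such a covering exists for $\varepsilon=1/n$ and does not exist for any $\varepsilon>1/n$).
   Context: An $H$-triangle is a triangle in the plane with one side parallel to the $x$-axis. "Cover" means the union of the covering triangles contains the given triangle. *)

theory Defs
  imports "HOL-Analysis.Analysis"
begin

definition H_triangle_vertices :: "real \<times> real \<Rightarrow> real \<times> real \<Rightarrow> real \<times> real \<Rightarrow> bool" where
  "H_triangle_vertices a b c \<longleftrightarrow>
     \<not> collinear {a, b, c} \<and> (snd a = snd b \<or> snd b = snd c \<or> snd c = snd a)"

definition H_triangle :: "(real \<times> real) set \<Rightarrow> bool" where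
  "H_triangle T \<longleftrightarrow> (\<exists>a b c. H_triangle_vertices a b c \<and> T = convex hull {a, b, c})"

text \<open>Both orientations (apex above or below the horizontal side) are allowed.\<close>

definition equilateral_H_triangle :: "real \<Rightarrow> (real \<times> real) set \<Rightarrow> bool" where
  "equilateral_H_triangle s T \<longleftrightarrow>
     (\<exists>a b c. H_triangle_vertices a b c \<and> T = convex hull {a, b, c} \<and>
        dist a b = s \<and> dist b c = s \<and> dist c a = s)"

lemma equilateral_H_triangle_imp_H_triangle:
  "equilateral_H_triangle s T \<Longrightarrow> H_triangle T"
  unfolding equilateral_H_triangle_def H_triangle_def by blast

definition coverable_by_unit_H_triangles :: "nat \<Rightarrow> (real \<times> real) set \<Rightarrow> bool" where
  "coverable_by_unit_H_triangles k T \<longleftrightarrow>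
     (\<exists>\<C>. finite \<C> \<and> card \<C> = k \<and> (\<forall>U\<in>\<C>. equilateral_H_triangle 1 U) \<and> T \<subseteq> \<Union>\<C>)"

end

theory Submission
  imports Defs "HOL-Number_Theory.Cong"
begin

text \<open>
  Lower bound: measure heights in units of the height of a unit triangle. Summing the lengths of the
  horizontal slices of the big triangle at the heights \<open>t, t + 1, \<dots>, t + n - 1\<close> gives
  \<open>n (n + \<epsilon> - t) - n (n - 1) / 2\<close>, whereas each unit triangle contributes at most
  \<open>1 - frac (b \<plusminus> t)\<close>. Hence the excess \<open>H t\<close> of the covering slices is nonnegative. Modulo 1 it is an
  affine function \<open>c + m t\<close> with \<open>m\<close> an integer, and \<open>m\<close> is odd because
  \<open>n\<^sup>2 + 3 + n\<close> is odd. So \<open>H t \<ge> frac (c + m t)\<close>, whose mean over \<open>[0, 1]\<close> is \<open>1/2\<close>, while the mean of \<open>H\<close>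
  is at most \<open>(3 - 2 n \<epsilon>) / 2\<close>. This yields \<open>n \<epsilon> \<le> 1\<close>.

  Construction: a covering of side \<open>n + 1/n\<close> extends to side \<open>n + 1 + 1/(n + 1)\<close> by one further row of height
  \<open>1 - 1/(n (n + 1))\<close> in which \<open>n + 1\<close> triangles of one orientation alternate with \<open>n\<close> of the other, the
  latter sticking out of the row.
\<close>

section \<open>Oblique coordinates and the normal form of equilateral H-triangles\<close>

text \<open>
  Oblique coordinates in which every equilateral H-triangle of side \<open>s\<close> is \<open>tri \<sigma> p q s\<close>, with
  \<open>\<sigma> = 1\<close> if the apex is above the horizontal side and \<open>\<sigma> = - 1\<close> if it is below.
\<close>
definition pt :: "real \<Rightarrow> real \<Rightarrow> real \<times> real" where
  "pt u v = (u + v / 2, sqrt 3 / 2 * v)"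

definition tri :: "int \<Rightarrow> real \<Rightarrow> real \<Rightarrow> real \<Rightarrow> (real \<times> real) set" where
  "tri \<sigma> p q s = {pt u v |u v. 0 \<le> \<sigma> * (u - p) \<and> 0 \<le> \<sigma> * (v - q) \<and> \<sigma> * (u - p) + \<sigma> * (v - q) \<le> s}"

lemma pt_inject [simp]: "pt u v = pt u' v' \<longleftrightarrow> u = u' \<and> v = v'"
  by (auto simp: pt_def)

lemma pt_surj: obtains u v where "z = pt u v"
proof
  show "z = pt (fst z - snd z / sqrt 3) (2 * snd z / sqrt 3)"
    by (auto simp: pt_def prod_eq_iff)
qed

lemma pt_mem_tri [simp]:
  "pt u v \<in> tri \<sigma> p q s \<longleftrightarrow> 0 \<le> \<sigma> * (u - p) \<and> 0 \<le> \<sigma> * (v - q) \<and> \<sigma> * (u - p) + \<sigma> * (v - q) \<le> s"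
  by (auto simp: tri_def)

lemma pt_combination:
  assumes "\<alpha> + \<beta> + \<gamma> = 1"
  shows "\<alpha> *\<^sub>R pt p q + \<beta> *\<^sub>R pt (p + x) q + \<gamma> *\<^sub>R pt p (q + x) = pt (p + \<beta> * x) (q + \<gamma> * x)"
proof -
  have \<alpha>: "\<alpha> = 1 - \<beta> - \<gamma>" using assms by simp
  show ?thesis unfolding \<alpha> by (simp add: pt_def field_simps)
qed

text \<open>The barycentric weights of the second and third vertex are the oblique coordinates
  relative to the corner, times \<open>\<sigma>\<close> and divided by \<open>s\<close>; the
  inequalities defining \<open>tri\<close> say that all three weights are nonnegative.\<close>

lemma convex_hull_eq_tri:
  fixes \<sigma> :: int and p q s :: real
  assumes "\<bar>\<sigma>\<bar> = 1" "s > 0"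
  shows "convex hull {pt p q, pt (p + \<sigma> * s) q, pt p (q + \<sigma> * s)} = tri \<sigma> p q s" (is "?H = _")
proof (intro subset_antisym subsetI)
  have \<sigma>: "real_of_int \<sigma> * \<sigma> = 1" using assms(1) by (auto simp: abs_if split: if_splits)
  fix z assume "z \<in> ?H"
  then obtain \<alpha> \<beta> \<gamma> where *: "0 \<le> \<alpha>" "0 \<le> \<beta>" "0 \<le> \<gamma>" "\<alpha> + \<beta> + \<gamma> = 1"
    and z: "z = pt (p + \<beta> * (\<sigma> * s)) (q + \<gamma> * (\<sigma> * s))"
    unfolding convex_hull_3 by (auto simp: pt_combination)
  have "\<sigma> * (\<beta> * (\<sigma> * s)) = \<beta> * s" "\<sigma> * (\<gamma> * (\<sigma> * s)) = \<gamma> * s"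
    using \<sigma> by (simp_all add: algebra_simps)
  moreover have "(\<beta> + \<gamma>) * s \<le> 1 * s" using * assms by (intro mult_right_mono) auto
  ultimately show "z \<in> tri \<sigma> p q s" using * assms by (auto simp: z algebra_simps)
next
  have \<sigma>: "real_of_int \<sigma> * \<sigma> = 1" using assms(1) by (auto simp: abs_if split: if_splits)
  fix z assume "z \<in> tri \<sigma> p q s"
  then obtain u v where z: "z = pt u v" and
    *: "0 \<le> \<sigma> * (u - p)" "0 \<le> \<sigma> * (v - q)" "\<sigma> * (u - p) + \<sigma> * (v - q) \<le> s"
    by (auto simp: tri_def)
  define \<beta> \<gamma> where "\<beta> = \<sigma> * (u - p) / s" and "\<gamma> = \<sigma> * (v - q) / s"
  have "\<beta> * (\<sigma> * s) = (real_of_int \<sigma> * \<sigma>) * (u - p)" "\<gamma> * (\<sigma> * s) = (real_of_int \<sigma> * \<sigma>) * (v - q)"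
    using assms by (simp_all add: \<beta>_def \<gamma>_def field_simps)
  hence "z = pt (p + \<beta> * (\<sigma> * s)) (q + \<gamma> * (\<sigma> * s))" using \<sigma> z by simp
  also have "\<dots> = (1 - \<beta> - \<gamma>) *\<^sub>R pt p q + \<beta> *\<^sub>R pt (p + \<sigma> * s) q + \<gamma> *\<^sub>R pt p (q + \<sigma> * s)"
    by (subst pt_combination) auto
  finally have "z = \<dots>" .
  moreover have "0 \<le> \<beta>" "0 \<le> \<gamma>" "\<beta> + \<gamma> \<le> 1"
    using * assms by (auto simp: \<beta>_def \<gamma>_def simp flip: add_divide_distrib)
  ultimately show "z \<in> ?H" unfolding convex_hull_3
    by (intro CollectI exI[of _ "1 - \<beta> - \<gamma>"] exI[of _ \<beta>] exI[of _ \<gamma>]) auto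
qed

text \<open>This is the quadratic form of the hexagonal lattice: the basis vectors behind
  \<open>pt\<close> are unit vectors at an angle of 60 degrees.\<close>

lemma dist_pt_power2: "(dist (pt u v) (pt u' v'))\<^sup>2 = (u - u')\<^sup>2 + (u - u') * (v - v') + (v - v')\<^sup>2"
proof -
  have "(dist (pt u v) (pt u' v'))\<^sup>2 = (u + v / 2 - (u' + v' / 2))\<^sup>2 + (sqrt 3 / 2 * v - sqrt 3 / 2 * v')\<^sup>2"
    by (simp add: pt_def dist_Pair_Pair dist_real_def)
  also have "\<dots> = (u - u' + (v - v') / 2)\<^sup>2 + (sqrt 3 / 2)\<^sup>2 * (v - v')\<^sup>2"
    by (simp add: power2_eq_square field_simps)
  also have "\<dots> = (u - u')\<^sup>2 + (u - u') * (v - v') + (v - v')\<^sup>2"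
    by (simp add: power_divide) (simp add: power2_eq_square field_simps)
  finally show ?thesis .
qed

lemma dist_pt: "dist (pt u v) (pt u' v') = sqrt ((u - u')\<^sup>2 + (u - u') * (v - v') + (v - v')\<^sup>2)"
  by (metis dist_pt_power2 real_sqrt_abs abs_of_nonneg zero_le_dist)

lemma equilateral_tri:
  fixes \<sigma> :: int and p q s :: real
  assumes "\<bar>\<sigma>\<bar> = 1" "s > 0"
  shows "equilateral_H_triangle s (tri \<sigma> p q s)"
proof -
  define x where "x = \<sigma> * s"
  have x: "x \<noteq> 0" "x\<^sup>2 = s\<^sup>2" using assms by (auto simp: x_def abs_if split: if_splits)
  have "\<not> collinear {pt p q, pt (p + x) q, pt p (q + x)}"
  proof
    assume "collinear {pt p q, pt (p + x) q, pt p (q + x)}"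
    hence "collinear {0, pt (p + x) q - pt p q, pt p (q + x) - pt p q}"
      by (subst (asm) insert_commute, subst (asm) collinear_3) simp
    moreover have "pt (p + x) q - pt p q = (x, 0)" "pt p (q + x) - pt p q = (x / 2, sqrt 3 / 2 * x)"
      by (simp_all add: pt_def field_simps)
    ultimately show False unfolding collinear_lemma using x by (auto simp: zero_prod_def)
  qed
  thus ?thesis
    unfolding equilateral_H_triangle_def H_triangle_vertices_def
    using x assms convex_hull_eq_tri[OF assms, of p q]
    by (intro exI[of _ "pt p q"] exI[of _ "pt (p + x) q"] exI[of _ "pt p (q + x)"])
       (auto simp: x_def[symmetric] dist_pt power2_eq_square[symmetric], auto simp: pt_def power2_eq_square)
qed

text \<open>Subtracting the two remaining distance equations gives a linear relation for the third
  vertex. Substituting it leaves a quadratic with roots \<open>X = 0\<close> (apex above) and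
  \<open>X = s\<close> (apex below).\<close>

lemma equilateral_horizontal_side:
  assumes "dist a b = s" "dist b c = s" "dist c a = s" "s > 0" "snd a = snd b"
  obtains \<sigma> :: int and p q where "\<bar>\<sigma>\<bar> = 1" "convex hull {a, b, c} = tri \<sigma> p q s"
proof -
  have main: thesis if d: "dist a b = s" "dist b c = s" "dist c a = s" "snd a = snd b" "fst a \<le> fst b"
      and hull: "convex hull {a, b, c} = H" and H: "\<And>\<sigma> p q. \<bar>\<sigma>\<bar> = 1 \<Longrightarrow> H = tri \<sigma> p q s \<Longrightarrow> thesis" for a b c H
  proof -
    obtain u v where a: "a = pt u v" by (rule pt_surj)
    obtain u' v' where b: "b = pt u' v'" by (rule pt_surj)
    obtain x y where c: "c = pt x y" by (rule pt_surj)
    have v': "v' = v" using d(4) by (simp add: a b pt_def)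
    have "u \<le> u'" using d(5) by (simp add: a b v' pt_def)
    hence u': "u' = u + s" using d(1) by (simp add: a b v' dist_pt)
    define X Y where "X = x - u" and "Y = y - v"
    have e1: "X\<^sup>2 + X * Y + Y\<^sup>2 = s\<^sup>2"
      using dist_pt_power2[of x y u v] d(3) by (simp add: a c X_def Y_def)
    have "(s - X)\<^sup>2 + (s - X) * (- Y) + Y\<^sup>2 = s\<^sup>2"
      using dist_pt_power2[of u' v' x y] d(2)
      by (simp add: b c u' v' X_def Y_def algebra_simps power2_eq_square)
    hence "s * (s - 2 * X - Y) = 0" using e1 by (simp add: algebra_simps power2_eq_square)
    hence Y: "Y = s - 2 * X" using \<open>s > 0\<close> by simp
    have "X * (X - s) = 0" using e1 unfolding Y by (simp add: algebra_simps power2_eq_square)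
    hence "X = 0 \<or> X = s" by auto
    thus thesis
    proof
      assume "X = 0"
      hence "c = pt u (v + s)" using Y by (auto simp: c X_def Y_def)
      thus thesis using convex_hull_eq_tri[of 1 s u v] hull \<open>s > 0\<close>
        by (intro H[of 1 u v]) (auto simp: a b u' v')
    next
      assume "X = s"
      hence "c = pt (u + s) (v - s)" using Y by (auto simp: c X_def Y_def)
      \<comment> \<open>For \<open>\<sigma> = -1\<close> the corner in \<open>tri\<close> is the
        right end of the horizontal side.\<close>
      hence "{a, b, c} = {pt (u + s) v, pt u v, pt (u + s) (v - s)}" by (auto simp: a b u' v')
      thus thesis using convex_hull_eq_tri[of "-1" s "u + s" v] hull \<open>s > 0\<close>
        by (intro H[of "-1" "u + s" v]) auto
    qed
  qed
  show thesis
  proof (cases "fst a \<le> fst b")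
    case True
    show thesis by (rule main[of a b c]) (use assms True that in auto)
  next
    case False
    show thesis
      by (rule main[of b a c])
         (use assms False that in \<open>auto simp: dist_commute insert_commute\<close>)
  qed
qed

lemma equilateral_H_triangleE:
  assumes "equilateral_H_triangle s T"
  obtains \<sigma> :: int and p q where "\<bar>\<sigma>\<bar> = 1" "T = tri \<sigma> p q s"
proof -
  obtain a b c where nc: "\<not> collinear {a, b, c}" and T: "T = convex hull {a, b, c}"
    and side: "snd a = snd b \<or> snd b = snd c \<or> snd c = snd a"
    and d: "dist a b = s" "dist b c = s" "dist c a = s"
    using assms unfolding equilateral_H_triangle_def H_triangle_vertices_def by blast
  have "a \<noteq> b" using nc by auto
  hence s: "s > 0" using d by auto
  from side show thesis
  proof (elim disjE)
    assume "snd a = snd b"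
    thus thesis using equilateral_horizontal_side[OF d s] T that by metis
  next
    assume "snd b = snd c"
    moreover have "{b, c, a} = {a, b, c}" by auto
    ultimately show thesis using equilateral_horizontal_side[OF d(2,3,1) s] T that by metis
  next
    assume "snd c = snd a"
    moreover have "{c, a, b} = {a, b, c}" by auto
    ultimately show thesis using equilateral_horizontal_side[OF d(3,1,2) s] T that by metis
  qed
qed

section \<open>Construction of the covering\<close>

lemma coverable_by_at_most:
  assumes "finite \<C>" "card \<C> \<le> k" "\<forall>U\<in>\<C>. equilateral_H_triangle 1 U" "T \<subseteq> \<Union>\<C>"
  shows "coverable_by_unit_H_triangles k T"
proof -
  \<comment> \<open>Distinct superfluous triangles raise the cardinality to exactly \<open>k\<close>.\<close>
  have "inj (\<lambda>p. tri 1 p 0 1)"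
  proof (rule injI)
    fix p p' assume "tri 1 p 0 1 = tri 1 p' 0 1"
    hence "pt p 0 \<in> tri 1 p' 0 1" "pt p' 0 \<in> tri 1 p 0 1"
      by (metis (no_types) pt_mem_tri add_0 diff_self le_numeral_extra(3,4) mult_zero_right zero_le_one)+
    thus "p = p'" by simp
  qed
  hence "infinite (range (\<lambda>p. tri 1 p 0 1))" by (simp add: finite_image_iff infinite_UNIV_char_0)
  hence "infinite (range (\<lambda>p. tri 1 p 0 1) - \<C>)" using assms(1) by simp
  then obtain \<D> where D: "\<D> \<subseteq> range (\<lambda>p. tri 1 p 0 1) - \<C>" "finite \<D>" "card \<D> = k - card \<C>"
    using infinite_arbitrarily_large by metis
  have "card (\<C> \<union> \<D>) = card \<C> + card \<D>" using D assms(1) by (intro card_Un_disjoint) auto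
  hence "card (\<C> \<union> \<D>) = k" using D assms(2) by simp
  moreover have "equilateral_H_triangle 1 U" if "U \<in> \<C> \<union> \<D>" for U
    using that D(1) assms(3) equilateral_tri[of 1 1 _ 0] by auto
  ultimately show ?thesis unfolding coverable_by_unit_H_triangles_def
    using assms(1,4) D(2) by (intro exI[of _ "\<C> \<union> \<D>"]) auto
qed

text \<open>At level \<open>b\<close> of the row, a triangle of orientation \<open>\<sigma>\<close>
  has slice length \<open>1 - b\<close>, and one of opposite orientation with its side on the far
  edge of the row has \<open>1 - (h - b)\<close>. The sum \<open>2 - h\<close> is independent of
  \<open>b\<close>, so alternating them with this period leaves no gaps. The bound on
  \<open>W\<close> is \<open>k * (2 - h) + 1\<close>, the reach of the last triangle of orientation
  \<open>\<sigma>\<close>.\<close>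

lemma coverable_add_row:
  fixes \<sigma> :: int and p q h W :: real and k K :: nat
  assumes \<sigma>: "\<bar>\<sigma>\<bar> = 1" and h: "0 \<le> h" "h \<le> 1" and W: "W \<le> 2 * k + 1 - k * h"
    and cov: "coverable_by_unit_H_triangles K (tri \<sigma> p (q + \<sigma> * h) (W - h))"
  shows "coverable_by_unit_H_triangles (K + 2 * k + 1) (tri \<sigma> p q W)"
proof -
  have \<sigma>\<sigma>: "real_of_int \<sigma> * \<sigma> = 1" using \<sigma> by (auto simp: abs_if split: if_splits)
  have \<sigma>2: "real_of_int \<sigma> * (\<sigma> * x) = x" for x :: real using \<sigma>\<sigma> by (simp flip: mult.assoc)
  obtain \<C> where C: "finite \<C>" "card \<C> = K" "\<forall>U\<in>\<C>. equilateral_H_triangle 1 U"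
      "tri \<sigma> p (q + \<sigma> * h) (W - h) \<subseteq> \<Union>\<C>"
    using cov unfolding coverable_by_unit_H_triangles_def by blast
  define up where "up = (\<lambda>i::nat. tri \<sigma> (p + \<sigma> * (i * (2 - h))) q 1)"
  define dn where "dn = (\<lambda>i::nat. tri (- \<sigma>) (p + \<sigma> * ((i + 1) * (2 - h))) (q + \<sigma> * h) 1)"
  define \<D> where "\<D> = \<C> \<union> (up ` {..k} \<union> dn ` {..<k})"
  \<comment> \<open>Coincidences between triangles are harmless, since
    \<open>coverable_by_at_most\<close> asks only for an upper bound.\<close>
  have "card (up ` {..k} \<union> dn ` {..<k}) \<le> (k + 1) + k"
    by (intro order.trans[OF card_Un_le] add_mono order.trans[OF card_image_le]) auto
  hence card: "card \<D> \<le> K + 2 * k + 1"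
    unfolding \<D>_def using C(2) card_Un_le[of \<C> "up ` {..k} \<union> dn ` {..<k}"] by linarith
  have "tri \<sigma> p q W \<subseteq> \<Union>\<D>"
  proof
    fix z assume "z \<in> tri \<sigma> p q W"
    then obtain u v where z: "z = pt u v" by (auto simp: tri_def)
    define a b where "a = \<sigma> * (u - p)" and "b = \<sigma> * (v - q)"
    have ab: "0 \<le> a" "0 \<le> b" "a + b \<le> W"
      using \<open>z \<in> _\<close> by (auto simp: z a_def b_def)
    show "z \<in> \<Union>\<D>"
    proof (cases "b \<ge> h")
      case True
      have "\<sigma> * (v - (q + \<sigma> * h)) = b - h"
        using \<sigma>2[of h] by (simp add: b_def algebra_simps)
      hence "z \<in> tri \<sigma> p (q + \<sigma> * h) (W - h)" using True ab by (simp add: z a_def[symmetric])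
      thus ?thesis using C(4) by (auto simp: \<D>_def)
    next
      case False
      \<comment> \<open>The period containing \<open>a\<close>, capped at \<open>k\<close>: the last
        triangle has no inverted neighbour beyond it, and there the bound on \<open>W\<close> takes
        over.\<close>
      define i where "i = min k (nat \<lfloor>a / (2 - h)\<rfloor>)"
      define r where "r = a - i * (2 - h)"
      have "real i \<le> a / (2 - h)" unfolding i_def using ab h
        by (smt (verit, best) divide_nonneg_nonneg min.cobounded2 of_nat_floor of_nat_mono)
      hence r0: "r \<ge> 0" using h by (simp add: r_def field_simps)
      have \<open>r \<le> 1 - b \<or> (i < k \<and> r \<le> 2 - h)\<close>
      proof (cases "i < k")
        case True
        hence "i = nat \<lfloor>a / (2 - h)\<rfloor>" by (auto simp: i_def)
        hence "a / (2 - h) \<le> real i + 1" by linarith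
        hence "r \<le> 2 - h" using h by (simp add: r_def field_simps)
        thus ?thesis using True by simp
      next
        case False
        hence "i = k" by (auto simp: i_def)
        thus ?thesis using ab W by (simp add: r_def algebra_simps)
      qed
      moreover have "z \<in> up i" if "r \<le> 1 - b"
      proof -
        have "\<sigma> * (u - (p + \<sigma> * (i * (2 - h)))) = r"
          using \<sigma>2[of "i * (2 - h)"] by (simp add: r_def a_def algebra_simps)
        thus ?thesis using that r0 ab by (simp add: z up_def b_def[symmetric])
      qed
      moreover have "z \<in> dn i" if "r > 1 - b" "r \<le> 2 - h"
      proof -
        have "- \<sigma> * (u - (p + \<sigma> * ((i + 1) * (2 - h)))) = 2 - h - r"
          using \<sigma>2[of "(i + 1) * (2 - h)"] by (simp add: r_def a_def algebra_simps)
        moreover have "- \<sigma> * (v - (q + \<sigma> * h)) = h - b"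
          using \<sigma>2[of h] by (simp add: b_def algebra_simps)
        ultimately show ?thesis using that False by (simp add: z dn_def)
      qed
      moreover have "i \<le> k" by (simp add: i_def)
      ultimately show ?thesis unfolding \<D>_def by (cases "r \<le> 1 - b") auto
    qed
  qed
  moreover have "\<forall>U\<in>\<D>. equilateral_H_triangle 1 U"
    using C(3) \<sigma> by (auto simp: \<D>_def up_def dn_def intro!: equilateral_tri)
  moreover have "finite \<D>" using C(1) by (simp add: \<D>_def)
  ultimately show ?thesis using card by (intro coverable_by_at_most[of \<D>])
qed

lemma coverable_tri:
  fixes \<sigma> :: int and p q :: real and n :: nat
  assumes "\<bar>\<sigma>\<bar> = 1" "n \<ge> 1"
  shows "coverable_by_unit_H_triangles (n\<^sup>2 + 3) (tri \<sigma> p q (n + 1 / n))"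
  using assms(2)
proof (induction n arbitrary: p q rule: dec_induct)
  case base
  \<comment> \<open>Side 2 splits into one unit triangle and a full row of height 1 with three
    triangles.\<close>
  have "coverable_by_unit_H_triangles 1 (tri \<sigma> p (q + \<sigma> * (1::real)) (2 - 1 :: real))"
    using assms(1) by (intro coverable_by_at_most[of "{tri \<sigma> p (q + \<sigma> * (1::real)) 1}"]) (auto intro: equilateral_tri)
  hence "coverable_by_unit_H_triangles (1 + 2 * 1 + 1) (tri \<sigma> p q 2)"
    by (intro coverable_add_row[where h = 1]) (use assms in auto)
  thus ?case by (simp add: numeral_eq_Suc)
next
  case (step n)
  \<comment> \<open>The difference of the two consecutive sides, so that the induction hypothesis
    covers what lies beyond the row. With \<open>k = n\<close> the bound on \<open>W\<close> then
    holds with equality, and the count grows by \<open>2 * n + 1\<close>.\<close>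
  define h :: real where "h = 1 - 1 / (real n * (real n + 1))"
  have n: "real n \<ge> 1" using step by simp
  have "real n * (real n + 1) \<ge> 1 * 1" using n by (intro mult_mono) auto
  hence "1 / (real n * (real n + 1)) \<le> 1" by (subst divide_le_eq_1_pos) linarith+
  moreover have "0 \<le> 1 / (real n * (real n + 1))" by simp
  ultimately have h: "0 \<le> h" "h \<le> 1" unfolding h_def by linarith+
  have "real n + real n * real n \<noteq> 0" using n add_pos_nonneg[of "real n" "real n * real n"] by simp
  hence h_eq: "h = 1 - (1 / n - 1 / (n + 1))" and nh: "n * h = n - 1 / (real n + 1)"
    using n by (simp_all add: h_def field_simps)
  have eq: "Suc n + 1 / Suc n - h = n + 1 / n" by (simp add: h_eq algebra_simps)
  have W: "Suc n + 1 / Suc n \<le> 2 * n + 1 - n * h" unfolding nh by (simp add: algebra_simps)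
  have "coverable_by_unit_H_triangles (n\<^sup>2 + 3) (tri \<sigma> p (q + \<sigma> * h) (Suc n + 1 / Suc n - h))"
    unfolding eq by (rule step.IH)
  from coverable_add_row[OF assms(1) h W this]
  have "coverable_by_unit_H_triangles (n\<^sup>2 + 3 + 2 * n + 1) (tri \<sigma> p q (Suc n + 1 / Suc n))" .
  thus ?case by (simp add: power2_eq_square algebra_simps)
qed

section \<open>Averages of fractional parts\<close>

lemma sum_lessThan_real: "(\<Sum>k<n. real k) = real n * (real n - 1) / 2"
  by (induction n) (simp_all add: algebra_simps add_divide_distrib diff_divide_distrib)

text \<open>A discrete form of the mean 1/2 of \<open>frac\<close>. Rounding \<open>x\<close> down
  to a multiple of \<open>1 / M\<close> turns the terms into \<open>r k / M\<close>, where
  \<open>r\<close> permutes the residues modulo \<open>M\<close> by coprimality.\<close>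

lemma sum_frac_ge:
  fixes m :: int and M :: nat and x :: real
  assumes "coprime m (int M)" "M > 0"
  shows "(real M - 1) / 2 \<le> (\<Sum>k<M. frac (x + m * (k / M)))"
proof -
  define i where "i = \<lfloor>M * x\<rfloor>"
  define r where "r = (\<lambda>k::nat. nat ((i + m * k) mod M))"
  have r: "int (r k) = (i + m * k) mod M" for k using assms by (simp add: r_def)
  have "inj_on r {..<M}"
  proof (rule inj_onI)
    fix k l assume kl: "k \<in> {..<M}" "l \<in> {..<M}" "r k = r l"
    hence "[i + m * k = i + m * l] (mod M)" using r by (metis cong_def)
    hence "[m * k = m * l] (mod M)" by (simp add: cong_add_lcancel)
    hence "[int k = int l] (mod M)" using assms(1) by (simp add: cong_mult_lcancel)
    thus "k = l" using kl by (simp add: cong_int_iff cong_less_modulus_unique_nat)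
  qed
  moreover have "r ` {..<M} \<subseteq> {..<M}" using assms(2) by (auto simp: r_def nat_less_iff)
  ultimately have bij: "bij_betw r {..<M} {..<M}"
    by (simp add: bij_betw_def endo_inj_surj)
  have le: "real (r k) / M \<le> frac (x + m * (k / M))" for k
  proof -
    define B where "B = i + m * k"
    define z where "z = x + m * (k / M)"
    have Mz: "M * z = M * x + m * k" using assms(2) by (simp add: z_def field_simps)
    have "of_int i \<le> M * x" "M * x < of_int i + 1" by (auto simp: i_def)
    hence B: "of_int B \<le> M * z" "M * z < of_int B + 1" by (auto simp: B_def Mz)
    have B': "B = B mod M + M * (B div M)" by simp
    hence Br: "real_of_int B = real_of_int (B mod M) + real M * real_of_int (B div M)" by (metis of_int_add of_int_mult of_int_of_nat_eq)
    \<comment> \<open>By integrality the whole interval from \<open>B\<close> to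
      \<open>B + 1\<close> stays within one block of length \<open>M\<close>, so \<open>z\<close>
      has floor \<open>B div M\<close>.\<close>
    have "B mod M + 1 \<le> M" "0 \<le> B mod M" using assms(2) by (simp_all add: add1_zle_eq)
    hence "real_of_int (B mod M) + 1 \<le> M" "0 \<le> real_of_int (B mod M)" by linarith+
    moreover have "M * (real_of_int (B div M) + 1) = real M * real_of_int (B div M) + M" by (simp add: distrib_left)
    ultimately have "real M * real_of_int (B div M) \<le> M * z" "real M * z < M * (real_of_int (B div M) + 1)"
      using B Br by linarith+
    hence "of_int (B div M) \<le> z" "z < of_int (B div M) + 1"
      using assms(2) by (simp_all only: mult_le_cancel_left_pos mult_less_cancel_left_pos of_nat_0_less_iff)
    hence "\<lfloor>z\<rfloor> = B div M" by (simp add: floor_eq_iff)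
    moreover have "real (r k) / M = B / M - (B div M)"
    proof -
      have "real (r k) = real_of_int (B mod M)" unfolding B_def by (simp flip: r)
      also have "\<dots> = B - real M * real_of_int (B div M)" using Br by linarith
      finally show ?thesis using assms(2) by (simp add: diff_divide_distrib)
    qed
    moreover have "B / M \<le> z" using B(1) assms(2) by (simp add: field_simps)
    ultimately have "real (r k) / M \<le> frac z" by (simp add: frac_def)
    thus ?thesis by (simp add: z_def)
  qed
  have "(real M - 1) / 2 = (\<Sum>k<M. real k / M)"
    using assms(2) by (simp add: sum_lessThan_real flip: sum_divide_distrib)
  also have "\<dots> = (\<Sum>k<M. real (r k) / M)"
    using sum.reindex_bij_betw[OF bij, of "\<lambda>k. real k / M"] by simp
  also have "\<dots> \<le> (\<Sum>k<M. frac (x + m * (k / M)))" by (intro sum_mono le)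
  finally show ?thesis .
qed

text \<open>\<open>frac y\<close> is the least nonnegative real congruent to \<open>y\<close> modulo
  1.\<close>

lemma frac_le_of_nonneg:
  fixes x y :: real
  assumes "0 \<le> x" "x - y \<in> \<int>"
  shows "frac y \<le> x"
proof -
  obtain z where "x - y = of_int z" using assms(2) by (auto elim: Ints_cases)
  hence "x = y + of_int z" by simp
  hence "frac y = frac x" by (simp add: frac_def)
  thus ?thesis using assms(1) by (simp add: frac_def)
qed

section \<open>Horizontal slices of unit triangles\<close>

lemma interval_length_le_sum:
  fixes l w :: "'i \<Rightarrow> real"
  assumes "finite I" "{a..b} \<subseteq> (\<Union>i\<in>I. {l i..l i + w i})" "\<And>i. i \<in> I \<Longrightarrow> 0 \<le> w i"
  shows "b - a \<le> (\<Sum>i\<in>I. w i)"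
proof (cases "a \<le> b")
  case True
  have "b - a = measure lborel {a..b}" using True by simp
  also have "\<dots> \<le> measure lborel (\<Union>i\<in>I. {l i..l i + w i})"
    using assms(1,2) by (intro measure_mono_fmeasurable fmeasurable_compact compact_UN) auto
  also have "\<dots> \<le> (\<Sum>i\<in>I. measure lborel {l i..l i + w i})"
    using assms(1) by (intro measure_UNION_le) auto
  also have "\<dots> = (\<Sum>i\<in>I. w i)" using assms(3) by (intro sum.cong) auto
  finally show ?thesis .
next
  case False
  thus ?thesis using sum_nonneg[of I w] assms(3) by fastforce
qed

text \<open>
  \<open>width z\<close> is the length of the slice of a unit triangle at distance \<open>z\<close> from its horizontal side; it
  vanishes unless \<open>0 \<le> z < 1\<close>.
\<close>
definition width :: "real \<Rightarrow> real" where
  "width z = (if \<lfloor>z\<rfloor> = 0 then 1 - frac z else 0)"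

lemma width_nonneg: "0 \<le> width z"
  by (simp add: width_def less_imp_le[OF frac_lt_1])

lemma unit_tri_slice:
  fixes \<sigma> :: int and p q v :: real
  assumes "\<bar>\<sigma>\<bar> = 1"
  obtains l where "{u. pt u v \<in> tri \<sigma> p q 1} \<subseteq> {l..l + width (\<sigma> * (v - q))}"
proof -
  define z where "z = \<sigma> * (v - q)"
  have "{u. pt u v \<in> tri \<sigma> p q 1} \<subseteq> {l..l + width z}"
    if "l = (if \<sigma> = 1 then p else p - width z)" for l
  proof
    fix u assume "u \<in> {u. pt u v \<in> tri \<sigma> p q 1}"
    hence *: "0 \<le> \<sigma> * (u - p)" "0 \<le> z" "\<sigma> * (u - p) \<le> 1 - z" by (auto simp: z_def)
    \<comment> \<open>At the apex, \<open>z = 1\<close>, the floor is 1 and \<open>width\<close>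
      takes its default value 0, which is again \<open>1 - z\<close>.\<close>
    hence "width z = 1 - z"
      by (cases "z = 1") (auto simp: width_def frac_def floor_eq_iff)
    thus "u \<in> {l..l + width z}" using * assms that by (auto simp: abs_if split: if_splits)
  qed
  thus thesis using that unfolding z_def by blast
qed

text \<open>The arguments differ by integers, so they share one fractional part, and at most one of
  them has floor 0.\<close>

lemma sum_width_le:
  fixes \<sigma> :: int and x :: real
  assumes "\<bar>\<sigma>\<bar> = 1"
  shows "(\<Sum>j<n. width (x + \<sigma> * real j)) \<le> 1 - frac x"
proof -
  have floor: "\<lfloor>x + \<sigma> * real j\<rfloor> = \<lfloor>x\<rfloor> + \<sigma> * int j" for j
  proof -
    have "x + \<sigma> * real j = x + of_int (\<sigma> * int j)" by simp
    thus ?thesis by (metis floor_add_int)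
  qed
  have width: "width (x + \<sigma> * real j) = (if \<lfloor>x\<rfloor> + \<sigma> * int j = 0 then 1 - frac x else 0)" for j
  proof -
    have "frac (x + \<sigma> * real j) = frac x" by (simp add: frac_def floor)
    thus ?thesis by (simp add: width_def floor)
  qed
  have unique: "j = i" if "\<lfloor>x\<rfloor> + \<sigma> * int j = 0" "\<lfloor>x\<rfloor> + \<sigma> * int i = 0" for i j
    using that assms by (auto simp: abs_if split: if_splits)
  have "(\<Sum>j<n. width (x + \<sigma> * real j)) \<le>
      (\<Sum>j<n. if j = nat (- (\<sigma> * \<lfloor>x\<rfloor>)) then 1 - frac x else 0)"
    unfolding width using assms frac_lt_1[of x]
    by (intro sum_mono) (auto simp: abs_if less_imp_le split: if_splits)
  also have "\<dots> \<le> 1 - frac x" using frac_lt_1[of x] by (simp add: less_imp_le)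
  finally show ?thesis .
qed

section \<open>Upper bound on the side\<close>

text \<open>The averaging argument with the geometry removed: \<open>s i\<close> stands for the
  orientation of a unit triangle relative to the big one, \<open>b i\<close> for its offset in
  height.\<close>

lemma sawtooth_sum_bound:
  fixes s :: "'i \<Rightarrow> int" and b :: "'i \<Rightarrow> real" and \<epsilon> :: real and n :: nat
  assumes "finite I" "card I = n\<^sup>2 + 3" and s: "\<And>i. i \<in> I \<Longrightarrow> \<bar>s i\<bar> = 1"
    and le: "\<And>t::real. 0 \<le> t \<Longrightarrow> t < 1 \<Longrightarrow>
      (\<Sum>j<n. n + \<epsilon> - t - j) \<le> (\<Sum>i\<in>I. 1 - frac (b i + s i * t))"
  shows "n * \<epsilon> \<le> 1"
proof -
  \<comment> \<open>The slope and constant term of \<open>H\<close> once every \<open>frac\<close>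
    is replaced by its argument and integers are dropped.\<close>
  define m where "m = int n - (\<Sum>i\<in>I. s i)"
  define c where "c = - (\<Sum>i\<in>I. b i) - n * \<epsilon>"
  define H where "H = (\<lambda>t::real. (\<Sum>i\<in>I. 1 - frac (b i + s i * t)) - (\<Sum>j<n. n + \<epsilon> - t - j))"
  have H_eq: "H t = (\<Sum>i\<in>I. 1 - frac (b i + s i * t)) - (n * (n + \<epsilon>) - real n * (real n - 1) / 2 - n * t)" for t :: real
    unfolding H_def sum_subtractf sum_lessThan_real by (simp add: algebra_simps)
  have "odd (s i)" if "i \<in> I" for i using s[OF that] by presburger
  hence "{i \<in> I. odd (s i)} = I" by auto
  hence "even (\<Sum>i\<in>I. s i) \<longleftrightarrow> even (n\<^sup>2 + 3)"
    using assms(1,2) by (simp add: even_sum_iff)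
  hence "odd m" by (auto simp: m_def)
  have H: "frac (c + m * t) \<le> H t" if "0 \<le> t" "t < 1" for t :: real
  proof (rule frac_le_of_nonneg)
    show "0 \<le> H t" using le[OF that] by (simp add: H_def)
    have "H t - (c + m * t) = (\<Sum>i\<in>I. 1 + real_of_int \<lfloor>b i + s i * t\<rfloor>) - n * n + real (\<Sum>j<n. j)"
      by (simp add: H_def c_def m_def frac_def sum.distrib sum_subtractf sum_distrib_right algebra_simps
          flip: sum_distrib_left)
    also have "\<dots> \<in> \<int>" by (intro Ints_add Ints_diff Ints_sum Ints_mult Ints_of_nat Ints_of_int Ints_1)
    finally show "H t - (c + m * t) \<in> \<int>" .
  qed
  \<comment> \<open>Averaging over the multiples of \<open>1/M\<close> instead of integrating; a power of two is coprime to the odd \<open>m\<close>.\<close>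
  have M: "2 * (n * \<epsilon> - 1) * M \<le> real n * n + 4 - n" if M: "M = 2 ^ K" for M K :: nat
  proof -
    have pos: "M > 0" using M by simp
    have "(real M - 1) / 2 \<le> (\<Sum>k<M. frac (c + m * (k / M)))"
      using sum_frac_ge[of m M c] \<open>odd m\<close> M by simp
    also have "\<dots> \<le> (\<Sum>k<M. H (k / M))" using pos by (intro sum_mono H) auto
    also have "\<dots> = (\<Sum>i\<in>I. \<Sum>k<M. 1 - frac (b i + s i * (k / M))) -
        (\<Sum>k<M. n * (n + \<epsilon>) - real n * (real n - 1) / 2 - n * (k / M))"
      unfolding H_eq by (subst sum.swap) (rule sum_subtractf)
    \<comment> \<open>Each single sawtooth has slope 1 or -1, coprime to every \<open>M\<close>, so
      its mean is controlled by the same lemma.\<close>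
    also have "(\<Sum>i\<in>I. \<Sum>k<M. 1 - frac (b i + s i * (k / M))) \<le> (\<Sum>i\<in>I. M - (real M - 1) / 2)"
    proof (intro sum_mono)
      fix i assume "i \<in> I"
      hence "coprime (s i) (int M)" using s[of i] by (auto simp: abs_if split: if_splits)
      from sum_frac_ge[OF this pos, of "b i"]
      show "(\<Sum>k<M. 1 - frac (b i + s i * (k / M))) \<le> M - (real M - 1) / 2"
        by (simp add: sum_subtractf pos)
    qed
    also have "\<dots> = (real n * n + 3) * (M + 1) / 2"
      using assms(2) by (simp add: field_simps power2_eq_square)
    also have "(\<Sum>k<M. n * (n + \<epsilon>) - real n * (real n - 1) / 2 - n * (k / M)) =
        M * (n * (n + \<epsilon>) - real n * (real n - 1) / 2) - n * (real M - 1) / 2"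
    proof -
      have "(\<Sum>k<M. n * (k / M)) = real n * ((\<Sum>k<M. real k) / M)"
        by (simp add: sum_distrib_left sum_divide_distrib)
      also have "\<dots> = n * (real M - 1) / 2" using pos by (simp add: sum_lessThan_real)
      finally show ?thesis by (simp add: sum_subtractf)
    qed
    finally show ?thesis by (simp add: field_simps)
  qed
  show ?thesis
  proof (rule ccontr)
    assume "\<not> ?thesis"
    hence pos: "2 * (n * \<epsilon> - 1) > 0" by simp
    \<comment> \<open>The right-hand side of fact \<open>M\<close> does not depend on the number of
      sample points, so a large power of two gives a contradiction.\<close>
    obtain K where "(real n * n + 4 - n) / (2 * (n * \<epsilon> - 1)) < 2 ^ K"
      using real_arch_pow[of 2] by auto
    hence "real n * n + 4 - n < 2 * (n * \<epsilon> - 1) * 2 ^ K"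
      using pos by (simp add: pos_divide_less_eq mult.commute)
    thus False using M[of "2 ^ K" K] by simp
  qed
qed

lemma coverable_tri_bound:
  fixes \<tau> :: int and p q \<epsilon> :: real and n :: nat
  assumes \<tau>: "\<bar>\<tau>\<bar> = 1" and cov: "coverable_by_unit_H_triangles (n\<^sup>2 + 3) (tri \<tau> p q (n + \<epsilon>))"
  shows "n * \<epsilon> \<le> 1"
proof (cases "\<epsilon> \<ge> 0")
  case True
  obtain \<C> where C: "finite \<C>" "card \<C> = n\<^sup>2 + 3" "\<forall>U\<in>\<C>. equilateral_H_triangle 1 U"
      "tri \<tau> p q (n + \<epsilon>) \<subseteq> \<Union>\<C>"
    using cov unfolding coverable_by_unit_H_triangles_def by blast
  have "\<forall>U\<in>\<C>. \<exists>\<sigma> P Q. \<bar>\<sigma>\<bar> = 1 \<and> U = tri \<sigma> P Q 1"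
    using C(3) equilateral_H_triangleE by metis
  then obtain \<sigma> P Q where U: "\<And>U. U \<in> \<C> \<Longrightarrow> \<bar>\<sigma> U\<bar> = 1" "\<And>U. U \<in> \<C> \<Longrightarrow> U = tri (\<sigma> U) (P U) (Q U) 1"
    by metis
  \<comment> \<open>Chosen so that the slice of the big triangle at distance \<open>t + j\<close>
    from its side lies at distance \<open>b U + s U * (t + j)\<close> from the side of
    \<open>U\<close>, both signed by orientation.\<close>
  define b s where "b = (\<lambda>U. \<sigma> U * (q - Q U))" and "s = (\<lambda>U. \<sigma> U * \<tau>)"
  have s: "\<bar>s U\<bar> = 1" if "U \<in> \<C>" for U using U(1)[OF that] \<tau> by (simp add: s_def abs_mult)
  have slice: "n + \<epsilon> - t - j \<le> (\<Sum>U\<in>\<C>. width (b U + s U * t + s U * real j))"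
    if "0 \<le> t" for t :: real and j :: nat
  proof -
    define v L where "v = q + \<tau> * (t + j)" and "L = n + \<epsilon> - t - j"
    have \<tau>v: "\<tau> * (v - q) = t + j" using \<tau> by (auto simp: v_def abs_if split: if_splits)
    have eq: "\<sigma> U * (v - Q U) = b U + s U * t + s U * real j" for U
      by (simp add: v_def b_def s_def algebra_simps)
    have "\<forall>U\<in>\<C>. \<exists>l. {u. pt u v \<in> U} \<subseteq> {l..l + width (\<sigma> U * (v - Q U))}"
      using U unit_tri_slice by metis
    then obtain l where l: "\<And>U. U \<in> \<C> \<Longrightarrow> {u. pt u v \<in> U} \<subseteq> {l U..l U + width (b U + s U * t + s U * real j)}"
      unfolding eq by metis
    \<comment> \<open>The slice starts on the line \<open>u = p\<close> if \<open>\<tau> = 1\<close>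
      and ends there if \<open>\<tau> = -1\<close>.\<close>
    define a where "a = (if \<tau> = 1 then p else p - L)"
    have "pt u v \<in> tri \<tau> p q (n + \<epsilon>)" if "u \<in> {a..a + L}" for u
      using that \<tau> \<open>0 \<le> t\<close> unfolding pt_mem_tri \<tau>v
      by (auto simp: a_def L_def abs_if split: if_splits)
    hence "{a..a + L} \<subseteq> (\<Union>U\<in>\<C>. {u. pt u v \<in> U})" using C(4) by blast
    also have "\<dots> \<subseteq> (\<Union>U\<in>\<C>. {l U..l U + width (b U + s U * t + s U * real j)})"
      using l by blast
    finally have "a + L - a \<le> (\<Sum>U\<in>\<C>. width (b U + s U * t + s U * real j))"
      by (intro interval_length_le_sum C(1) width_nonneg)
    thus ?thesis by (simp add: L_def)
  qed
  show ?thesis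
  proof (rule sawtooth_sum_bound[OF C(1,2) s])
    fix t :: real assume t: "0 \<le> t" "t < 1"
    have "(\<Sum>j<n. n + \<epsilon> - t - j) \<le> (\<Sum>j<n. \<Sum>U\<in>\<C>. width (b U + s U * t + s U * real j))"
      by (rule sum_mono, rule slice[OF t(1)])
    \<comment> \<open>Grouped by triangle, the \<open>n\<close> levels are spaced by 1, so each
      \<open>U\<close> counts at essentially one of them.\<close>
    also have "\<dots> = (\<Sum>U\<in>\<C>. \<Sum>j<n. width (b U + s U * t + s U * real j))" by (rule sum.swap)
    also have "\<dots> \<le> (\<Sum>U\<in>\<C>. 1 - frac (b U + s U * t))" by (intro sum_mono sum_width_le s)
    finally show "(\<Sum>j<n. n + \<epsilon> - t - j) \<le> (\<Sum>U\<in>\<C>. 1 - frac (b U + s U * t))" .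
  qed
next
  case False
  hence "n * \<epsilon> \<le> 0" by (simp add: mult_nonneg_nonpos)
  thus ?thesis by simp
qed

theorem theorem5:
  fixes n :: nat
  assumes "n \<ge> 1"
  shows "(\<forall>T. equilateral_H_triangle (real n + 1 / real n) T \<longrightarrow>
              coverable_by_unit_H_triangles (n\<^sup>2 + 3) T) \<and>
         (\<forall>\<epsilon>::real. \<epsilon> > 1 / real n \<longrightarrow>
            (\<forall>T. equilateral_H_triangle (real n + \<epsilon>) T \<longrightarrow>
                 \<not> coverable_by_unit_H_triangles (n\<^sup>2 + 3) T))"
proof (intro conjI allI impI)
  fix T assume "equilateral_H_triangle (real n + 1 / real n) T"
  thus "coverable_by_unit_H_triangles (n\<^sup>2 + 3) T"
    using coverable_tri assms by (metis equilateral_H_triangleE)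
next
  fix \<epsilon> :: real and T
  assume \<epsilon>: "\<epsilon> > 1 / real n" and "equilateral_H_triangle (real n + \<epsilon>) T"
  then obtain \<sigma> p q where "\<bar>\<sigma>\<bar> = 1" "T = tri \<sigma> p q (n + \<epsilon>)"
    using equilateral_H_triangleE by blast
  moreover have "n * \<epsilon> > 1" using \<epsilon> assms by (simp add: field_simps)
  ultimately show "\<not> coverable_by_unit_H_triangles (n\<^sup>2 + 3) T"
    using coverable_tri_bound by (metis not_less)
qed

end
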